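(* Let $n>2$, let $m_1>m_2>\cdots>m_n>0$ and $1+r>0$ be real numbers with $m_1>1+r>m_n$, and let $\mathcal{Q}$ be the set of equivalent martingale measures of the one-period $n$-nomial market model with parameters $m_1,\ldots,m_n$ and $1+r$. Let $\mathcal{F}$ be the power set of $\Omega=\{1,\ldots,n\}$ and let $\underline{Q}(A)=\min_{Q\in\mathrm{cl}(\mathcal{Q})}Q(A)$ for $A\in\mathcal{F}$. Then: (i) $\underline{Q}$ is completely monotone, that is, for every $k\ge2$ and every $A_1,\ldots,A_k\in\mathcal{F}$, $$\underline{Q}\left(\bigcup_{i=1}^kA_i\right)\ge\sum_{\emptyset\neq K\subseteq\{1,\ldots,k\}}(-1)^{|K|+1}\,\underline{Q}\left(\bigcap_{i\in K}A_i\right).$$ (ii) There exist two necessity measures $N_1,N_2:\mathcal{F}\to[0,1]$ and $\alpha\in(0,1)$ such that, for every $A\in\mathcal{F}$, $$\underline{Q}(A)=\alpha N_1(A)+(1-\alpha)N_2(A).$$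
   Context: One-period $n$-nomial market model: $\Omega=\{1,\ldots,n\}$, $\mathcal{F}$ is the power set of $\Omega$, and $P$ is a probability measure on $\mathcal{F}$ with $P(\{i\})>0$ for all $i\in\Omega$. There is a risk-free asset with $B_0=1$, $B_1=1+r>0$, and a risky asset with price $S_0>0$ at time $0$ and price $S_1(i)=m_iS_0$, $i\in\Omega$, at time $1$, where $m_1>\cdots>m_n>0$. The set of equivalent martingale measures is $$\mathcal{Q}=\{Q \text{ probability measure on }\mathcal{F}\,:\,(1+r)^{-1}\mathbb{E}_Q(S_1)=S_0,\ Q\sim P\},$$ where $Q\sim P$ means that $Q$ and $P$ have the same null sets (i.e. $Q(\{i\})>0$ for all $i$). Identifying a probability measure with the vector $(Q(\{1\}),\ldots,Q(\{n\}))^T$, $\mathrm{cl}(\mathcal{Q})$ denotes the closure of $\mathcal{Q}$ in $\mathbb{R}^n$. A (normalized) capacity is a function $\varphi:\mathcal{F}\to[0,1]$ with $\varphi(\emptyset)=0$, $\varphi(\Omega)=1$ and $\varphi(A)\le\varphi(B)$ whenever $A\subseteq B$. A necessity measure is a capacity $\varphi$ with $\varphi(A\cap B)=\min\{\varphi(A),\varphi(B)\}$ for all $A,B\in\mathcal{F}$. *)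

theory Defs
  imports "HOL-Probability.Probability"
begin

definition prob_on :: "'a set \<Rightarrow> 'a measure \<Rightarrow> bool" where
  "prob_on \<Omega> P \<longleftrightarrow> prob_space P \<and> sets P = Pow \<Omega>"

definition stock1 :: "(nat \<Rightarrow> real) \<Rightarrow> real \<Rightarrow> nat \<Rightarrow> real" where
  "stock1 m S0 i = m i * S0"

definition emm :: "nat \<Rightarrow> (nat \<Rightarrow> real) \<Rightarrow> real \<Rightarrow> real \<Rightarrow> nat measure \<Rightarrow> nat measure set" where
  "emm n m r S0 P =
     {Q. prob_on {1..n} Q \<and>
         inverse (1 + r) * (\<integral>i. stock1 m S0 i \<partial>Q) = S0 \<and>
         null_sets Q = null_sets P}"

text \<open>
  Vectors in \<open>\<real>\<^sup>n\<close> are extensional functions on \<open>{1..n}\<close>, and \<open>powertop_real {1..n}\<close> is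
  the Euclidean topology on them.
\<close>

definition prob_vec :: "nat \<Rightarrow> nat measure \<Rightarrow> nat \<Rightarrow> real" where
  "prob_vec n Q = (\<lambda>i\<in>{1..n}. measure Q {i})"

definition cl_measures :: "nat \<Rightarrow> nat measure set \<Rightarrow> (nat \<Rightarrow> real) set" where
  "cl_measures n \<Q> = powertop_real {1..n} closure_of (prob_vec n ` \<Q>)"

text \<open>
  A vector \<open>q\<close> is read back as the measure \<open>A \<mapsto> (\<Sum>i\<in>A. q i)\<close>. \<open>LEAST\<close> is
  the minimum, not the infimum: it is determined only if the minimum is attained.
\<close>

definition lower_env :: "nat \<Rightarrow> nat measure set \<Rightarrow> nat set \<Rightarrow> real" where
  "lower_env n \<Q> A = (LEAST x. x \<in> (\<lambda>q. \<Sum>i\<in>A. q i) ` cl_measures n \<Q>)"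

text \<open>
  The following set functions are only constrained on \<open>Pow \<Omega>\<close>; their values elsewhere are
  irrelevant.
\<close>

definition capacity :: "'a set \<Rightarrow> ('a set \<Rightarrow> real) \<Rightarrow> bool" where
  "capacity \<Omega> \<phi> \<longleftrightarrow>
     (\<forall>A\<in>Pow \<Omega>. \<phi> A \<in> {0..1}) \<and> \<phi> {} = 0 \<and> \<phi> \<Omega> = 1 \<and>
     (\<forall>A\<in>Pow \<Omega>. \<forall>B\<in>Pow \<Omega>. A \<subseteq> B \<longrightarrow> \<phi> A \<le> \<phi> B)"

definition necessity_measure :: "'a set \<Rightarrow> ('a set \<Rightarrow> real) \<Rightarrow> bool" where
  "necessity_measure \<Omega> \<phi> \<longleftrightarrow>
     capacity \<Omega> \<phi> \<and> (\<forall>A\<in>Pow \<Omega>. \<forall>B\<in>Pow \<Omega>. \<phi> (A \<inter> B) = min (\<phi> A) (\<phi> B))"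

definition completely_monotone :: "'a set \<Rightarrow> ('a set \<Rightarrow> real) \<Rightarrow> bool" where
  "completely_monotone \<Omega> \<phi> \<longleftrightarrow>
     (\<forall>k\<ge>2. \<forall>A :: nat \<Rightarrow> 'a set. (\<forall>i\<in>{1..k}. A i \<in> Pow \<Omega>) \<longrightarrow>
        \<phi> (\<Union>i\<in>{1..k}. A i) \<ge>
          (\<Sum>K | K \<noteq> {} \<and> K \<subseteq> {1..k}. (- 1) ^ (card K + 1) * \<phi> (\<Inter>i\<in>K. A i)))"

end

theory Submission
  imports Defs
begin

text \<open>
  Put \<open>d i = m i - (1 + r)\<close>. The closure of the martingale measures is the polytope of all
  probability vectors with \<open>d\<close>-mean zero. The lower probability of \<open>A\<close> depends on the complement
  \<open>B\<close> only: it vanishes if \<open>B\<close> carries a martingale measure, i.e. if \<open>d\<close> takes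
  values of both weak signs on \<open>B\<close>. If \<open>d > 0\<close> on \<open>B\<close>, it is the minimum over \<open>i \<in> B\<close> of
  \<open>d i / (d i - d n)\<close>, the mass that the measure supported by \<open>{i, n}\<close> puts on \<open>n\<close>; the case
  \<open>d < 0\<close> is symmetric, with \<open>1\<close> in place of \<open>n\<close>. The maxima of the two families of ratios,
  \<open>d 1 / (d 1 - d n)\<close> and \<open>d n / (d n - d 1)\<close>, add up to one, so after normalization the two
  minima are necessity measures with exactly these weights. Complete monotonicity follows because
  on values of a necessity measure inclusion-exclusion is the maximum-minimum identity.
\<close>

section \<open>Necessity measures\<close>

text \<open>Inclusion-exclusion for Lebesgue measure on the intervals \<open>{0..x i}\<close>: these
  are nested, so a union is as long as the longest and an intersection as long as the shortest. Sets
  of finite measure form a ring on which \<open>measure\<close> is additive.\<close>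

lemma maximum_minimum_identity:
  fixes x :: "'b \<Rightarrow> real"
  assumes I: "finite I" "I \<noteq> {}" and x: "\<And>i. i \<in> I \<Longrightarrow> 0 \<le> x i"
  shows "Max (x ` I) = (\<Sum>K | K \<noteq> {} \<and> K \<subseteq> I. (- 1) ^ (card K + 1) * Min (x ` K))"
proof -
  interpret Incl_Excl "\<lambda>S. S \<in> fmeasurable lborel" "measure (lborel :: real measure)"
    by unfold_locales
      (auto simp: fmeasurable.Un fmeasurable.Diff disjnt_def measure_Un2 Diff_triv Int_commute)
  have "measure lborel (\<Union>i\<in>I. {0..x i}) =
      (\<Sum>K | K \<subseteq> I \<and> K \<noteq> {}. (- 1) ^ (card K + 1) * measure lborel (\<Inter>i\<in>K. {0..x i}))"
    by (rule restricted_indexed) (use I in \<open>auto simp: fmeasurable_def emeasure_lborel_Icc_eq\<close>)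
  moreover have "measure lborel (\<Union>i\<in>I. {0..x i}) = Max (x ` I)"
  proof -
    have Max_iff: "t \<le> Max (x ` I) \<longleftrightarrow> (\<exists>i\<in>I. t \<le> x i)" for t
      using I by (subst Max_ge_iff) auto
    then have "(\<Union>i\<in>I. {0..x i}) = {0..Max (x ` I)}"
      by auto
    \<comment> \<open>The interval \<open>{0..t}\<close> has length \<open>t\<close> only for
      \<open>0 \<le> t\<close>.\<close>
    moreover have "0 \<le> Max (x ` I)"
      using I x Max_iff[of 0] by blast
    ultimately show ?thesis
      by simp
  qed
  moreover have "measure lborel (\<Inter>i\<in>K. {0..x i}) = Min (x ` K)" if K: "K \<subseteq> I" "K \<noteq> {}" for K
  proof -
    have Min_iff: "t \<le> Min (x ` K) \<longleftrightarrow> (\<forall>i\<in>K. t \<le> x i)" for t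
      using K finite_subset[OF _ I(1)] by (subst Min_ge_iff) auto
    then have "(\<Inter>i\<in>K. {0..x i}) = {0..Min (x ` K)}"
      using K(2) by auto
    moreover have "0 \<le> Min (x ` K)"
      using K x Min_iff[of 0] by blast
    ultimately show ?thesis
      by simp
  qed
  ultimately show ?thesis
    by (simp only: conj_commute) (auto intro!: sum.cong)
qed

lemma necessity_measure_INT:
  assumes N: "necessity_measure \<Omega> N" and K: "finite K" "K \<noteq> {}"
    and A: "\<And>i. i \<in> K \<Longrightarrow> A i \<in> Pow \<Omega>"
  shows "N (\<Inter>i\<in>K. A i) = Min ((\<lambda>i. N (A i)) ` K)"
  using K A
proof (induction K rule: finite_ne_induct)
  case (insert k K)
  have "(\<Inter>i\<in>K. A i) \<in> Pow \<Omega>"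
    using insert by blast
  then have "N (A k \<inter> (\<Inter>i\<in>K. A i)) = min (N (A k)) (N (\<Inter>i\<in>K. A i))"
    using N insert.prems unfolding necessity_measure_def by blast
  then show ?case
    using insert by simp
qed simp

lemma necessity_measure_completely_monotone:
  assumes N: "necessity_measure \<Omega> N"
  shows "completely_monotone \<Omega> N"
  unfolding completely_monotone_def
proof (intro allI impI)
  fix k :: nat and A :: "nat \<Rightarrow> 'a set"
  assume k: "2 \<le> k" and A: "\<forall>i\<in>{1..k}. A i \<in> Pow \<Omega>"
  have cap: "capacity \<Omega> N"
    using N by (simp add: necessity_measure_def)
  have nonneg: "0 \<le> N (A i)" if "i \<in> {1..k}" for i
    using cap A that by (auto simp: capacity_def)
  have "(\<Sum>K | K \<noteq> {} \<and> K \<subseteq> {1..k}. (- 1) ^ (card K + 1) * N (\<Inter>i\<in>K. A i)) =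
      (\<Sum>K | K \<noteq> {} \<and> K \<subseteq> {1..k}. (- 1) ^ (card K + 1) * Min ((\<lambda>i. N (A i)) ` K))"
  proof (intro sum.cong refl)
    fix K assume "K \<in> {K. K \<noteq> {} \<and> K \<subseteq> {1..k}}"
    then have "N (\<Inter>i\<in>K. A i) = Min ((\<lambda>i. N (A i)) ` K)"
      using A finite_subset[of K "{1..k}"] by (intro necessity_measure_INT[OF N]) auto
    then show "(- 1) ^ (card K + 1) * N (\<Inter>i\<in>K. A i) =
        (- 1) ^ (card K + 1) * Min ((\<lambda>i. N (A i)) ` K)"
      by simp
  qed
  also have "\<dots> = Max ((\<lambda>i. N (A i)) ` {1..k})"
    by (rule maximum_minimum_identity[symmetric]) (use k nonneg in auto)
  \<comment> \<open>The alternating sum has collapsed to the largest \<open>N (A i)\<close>, so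
    monotonicity of \<open>N\<close> gives the bound.\<close>
  also have "\<dots> \<le> N (\<Union>i\<in>{1..k}. A i)"
  proof -
    have "N (A i) \<le> N (\<Union>i\<in>{1..k}. A i)" if "i \<in> {1..k}" for i
    proof -
      have "A i \<in> Pow \<Omega>" "(\<Union>i\<in>{1..k}. A i) \<in> Pow \<Omega>" "A i \<subseteq> (\<Union>i\<in>{1..k}. A i)"
        using A that by blast+
      then show ?thesis
        using cap unfolding capacity_def by blast
    qed
    then show ?thesis
      using k by (intro Max.boundedI) auto
  qed
  finally show "(\<Sum>K | K \<noteq> {} \<and> K \<subseteq> {1..k}. (- 1) ^ (card K + 1) * N (\<Inter>i\<in>K. A i))
      \<le> N (\<Union>i\<in>{1..k}. A i)" .
qed

text \<open>The inequality is linear in the set function, and it involves only unions and nonempty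
  intersections of the \<open>A i\<close>, all of which lie in \<open>Pow \<Omega>\<close>.\<close>

lemma completely_monotone_combination:
  assumes "completely_monotone \<Omega> \<phi>" "completely_monotone \<Omega> \<psi>" "0 \<le> a" "0 \<le> b"
    and eq: "\<And>A. A \<in> Pow \<Omega> \<Longrightarrow> \<eta> A = a * \<phi> A + b * \<psi> A"
  shows "completely_monotone \<Omega> \<eta>"
  unfolding completely_monotone_def
proof (intro allI impI)
  fix k :: nat and A :: "nat \<Rightarrow> 'a set"
  assume k: "2 \<le> k" and A: "\<forall>i\<in>{1..k}. A i \<in> Pow \<Omega>"
  let ?S = "\<lambda>\<phi>. \<Sum>K | K \<noteq> {} \<and> K \<subseteq> {1..k}. (- 1) ^ (card K + 1) * \<phi> (\<Inter>i\<in>K. A i)"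
  have "?S \<eta> = (\<Sum>K | K \<noteq> {} \<and> K \<subseteq> {1..k}. (- 1) ^ (card K + 1) *
      (a * \<phi> (\<Inter>i\<in>K. A i) + b * \<psi> (\<Inter>i\<in>K. A i)))"
  proof (intro sum.cong refl)
    fix K assume "K \<in> {K. K \<noteq> {} \<and> K \<subseteq> {1..k}}"
    then have "(\<Inter>i\<in>K. A i) \<in> Pow \<Omega>"
      using A by blast
    then show "(- 1) ^ (card K + 1) * \<eta> (\<Inter>i\<in>K. A i) = (- 1) ^ (card K + 1) *
        (a * \<phi> (\<Inter>i\<in>K. A i) + b * \<psi> (\<Inter>i\<in>K. A i))"
      by (simp add: eq)
  qed
  also have "\<dots> = a * ?S \<phi> + b * ?S \<psi>"
    by (simp add: sum_distrib_left algebra_simps flip: sum.distrib)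
  also have "\<dots> \<le> a * \<phi> (\<Union>i\<in>{1..k}. A i) + b * \<psi> (\<Union>i\<in>{1..k}. A i)"
    using assms(1,2) k A unfolding completely_monotone_def
    by (intro add_mono mult_left_mono \<open>0 \<le> a\<close> \<open>0 \<le> b\<close>) blast+
  also have "\<dots> = \<eta> (\<Union>i\<in>{1..k}. A i)"
    using A by (intro eq[symmetric]) blast
  finally show "?S \<eta> \<le> \<eta> (\<Union>i\<in>{1..k}. A i)" .
qed

text \<open>For \<open>b\<close> with values in \<open>{0..1}\<close> and a zero, this is the
  necessity measure of the possibility distribution \<open>1 - b\<close>. The inserted
  \<open>1\<close> supplies the value at \<open>A = \<Omega>\<close>, where no point remains
  outside.\<close>

definition min_outside :: "'a set \<Rightarrow> ('a \<Rightarrow> real) \<Rightarrow> 'a set \<Rightarrow> real" where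
  "min_outside \<Omega> b A = Min (insert 1 (b ` (\<Omega> - A)))"

lemma min_outside_eq:
  assumes "finite \<Omega>" "k \<in> \<Omega> - A" "b k \<le> 1" "\<And>i. i \<in> \<Omega> - A \<Longrightarrow> b k \<le> b i"
  shows "min_outside \<Omega> b A = b k"
  unfolding min_outside_def using assms by (intro Min_eqI) auto

text \<open>Complements turn \<open>A \<inter> B\<close> into a union, and the minimum over a union
  is the smaller of the two minima. The zero of \<open>b\<close> at \<open>z\<close> gives the value
  0 at the empty set.\<close>

lemma necessity_measure_min_outside:
  assumes fin: "finite \<Omega>" and b: "\<And>i. i \<in> \<Omega> \<Longrightarrow> b i \<in> {0..1}" and z: "z \<in> \<Omega>" "b z = 0"
  shows "necessity_measure \<Omega> (min_outside \<Omega> b)"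
proof -
  have "min_outside \<Omega> b (A \<inter> B) = min (min_outside \<Omega> b A) (min_outside \<Omega> b B)" for A B
  proof -
    have "insert 1 (b ` (\<Omega> - A \<inter> B)) = insert 1 (b ` (\<Omega> - A)) \<union> insert 1 (b ` (\<Omega> - B))"
      by blast
    then show ?thesis
      unfolding min_outside_def using fin by (subst Min_Un[symmetric]) auto
  qed
  moreover have "min_outside \<Omega> b {} = 0"
    using min_outside_eq[OF fin, of z "{}" b] z b by auto
  moreover have "min_outside \<Omega> b A \<in> {0..1}" for A
    unfolding min_outside_def using fin b by auto
  moreover have "min_outside \<Omega> b A \<le> min_outside \<Omega> b B" if "A \<subseteq> B" for A B
    unfolding min_outside_def using that fin by (intro Min_antimono) auto
  ultimately show ?thesis
    by (auto simp: necessity_measure_def capacity_def min_outside_def)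
qed

section \<open>The polytope of martingale vectors\<close>

text \<open>The weak inequalities make the set closed; extensionality gives each vector a single
  representative.\<close>

definition mart_vecs :: "'a set \<Rightarrow> ('a \<Rightarrow> real) \<Rightarrow> ('a \<Rightarrow> real) set" where
  "mart_vecs \<Omega> d = {q \<in> extensional \<Omega>. (\<forall>i\<in>\<Omega>. 0 \<le> q i) \<and> sum q \<Omega> = 1 \<and> (\<Sum>i\<in>\<Omega>. q i * d i) = 0}"

lemma mart_vecs_uminus: "mart_vecs \<Omega> (\<lambda>i. - d i) = mart_vecs \<Omega> d"
  by (simp add: mart_vecs_def sum_negf)

definition two_point :: "'a set \<Rightarrow> 'a \<Rightarrow> 'a \<Rightarrow> real \<Rightarrow> 'a \<Rightarrow> real" where
  "two_point \<Omega> i j s = (\<lambda>k\<in>\<Omega>. (1 - s) * of_bool (k = i) + s * of_bool (k = j))"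

lemma sum_two_point:
  assumes "finite \<Omega>" "A \<subseteq> \<Omega>"
  shows "(\<Sum>k\<in>A. two_point \<Omega> i j s k * f k) =
    (1 - s) * of_bool (i \<in> A) * f i + s * of_bool (j \<in> A) * f j"
proof -
  have "(\<Sum>k\<in>A. two_point \<Omega> i j s k * f k) =
      (\<Sum>k\<in>A. (if k = i then (1 - s) * f i else 0) + (if k = j then s * f j else 0))"
    using assms(2) by (intro sum.cong) (auto simp: two_point_def algebra_simps)
  then show ?thesis
    using finite_subset[OF assms(2,1)] by (simp add: sum.distrib)
qed

lemma two_point_in_mart_vecs:
  assumes "finite \<Omega>" "i \<in> \<Omega>" "j \<in> \<Omega>" "d j < 0" "0 \<le> d i"
  shows "two_point \<Omega> i j (d i / (d i - d j)) \<in> mart_vecs \<Omega> d"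
proof -
  \<comment> \<open>The mass on \<open>j\<close> that solves the mean-zero equation on
    \<open>{i, j}\<close>; the signs of \<open>d i\<close> and \<open>d j\<close> place it between 0
    and 1.\<close>
  define s where "s = d i / (d i - d j)"
  have s: "0 \<le> s" "s \<le> 1" "(1 - s) * d i + s * d j = 0"
    using assms by (auto simp: s_def field_simps)
  then show ?thesis
    using assms(1-3) sum_two_point[of \<Omega> \<Omega> i j s "\<lambda>_. 1"] sum_two_point[of \<Omega> \<Omega> i j s d]
    by (auto simp: mart_vecs_def s_def[symmetric] two_point_def)
qed

section \<open>Lower probabilities over the polytope\<close>

locale mean_zero =
  fixes \<Omega> :: "'a set" and d :: "'a \<Rightarrow> real" and lo hi :: 'a
  assumes finite: "finite \<Omega>" and lo: "lo \<in> \<Omega>" "d lo < 0" and hi: "hi \<in> \<Omega>" "0 < d hi"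
    and bounds: "\<And>i. i \<in> \<Omega> \<Longrightarrow> d lo \<le> d i" "\<And>i. i \<in> \<Omega> \<Longrightarrow> d i \<le> d hi"
begin

definition weight :: real where
  "weight = d hi / (d hi - d lo)"

text \<open>The masses on \<open>lo\<close> of the two-point vectors on \<open>{i, lo}\<close>,
  scaled to have maximum 1. The value 0 for \<open>d i \<le> 0\<close> makes the minimum vanish once
  such a point lies outside \<open>A\<close>.\<close>

definition ratio :: "'a \<Rightarrow> real" where
  "ratio i = (if 0 < d i then d i / (d i - d lo) / weight else 0)"

definition is_lower :: "'a set \<Rightarrow> real \<Rightarrow> bool" where
  "is_lower A v \<longleftrightarrow> (\<forall>q\<in>mart_vecs \<Omega> d. v \<le> sum q A) \<and> (\<exists>q\<in>mart_vecs \<Omega> d. sum q A = v)"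

lemma weight: "0 < weight" "weight < 1"
  using lo hi by (auto simp: weight_def)

text \<open>As \<open>d lo < 0\<close>, the quotient \<open>t / (t - d lo)\<close> increases for
  \<open>t > 0\<close>. Hence the minimum of \<open>ratio\<close> sits at the point of smallest
  \<open>d\<close>.\<close>

lemma ratio_mono:
  assumes "i \<in> \<Omega>" "j \<in> \<Omega>" "d i \<le> d j"
  shows "ratio i \<le> ratio j"
proof (cases "0 < d i")
  case True
  then have "d i / (d i - d lo) \<le> d j / (d j - d lo)"
    using assms lo by (auto simp: divide_simps algebra_simps)
  then have "d i / (d i - d lo) / weight \<le> d j / (d j - d lo) / weight"
    using weight by (intro divide_right_mono) auto
  then show ?thesis
    using True assms by (simp add: ratio_def)
next
  case False
  then show ?thesis
    using lo weight by (auto simp: ratio_def)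
qed

lemma ratio_bounds:
  assumes "i \<in> \<Omega>"
  shows "0 \<le> ratio i" "ratio i \<le> 1"
proof -
  have "ratio hi = 1"
    using hi weight by (simp add: ratio_def weight_def[symmetric])
  then show "ratio i \<le> 1"
    using ratio_mono[of i hi] assms hi bounds by simp
  show "0 \<le> ratio i"
    using weight lo by (auto simp: ratio_def)
qed

lemma necessity_measure_ratio: "necessity_measure \<Omega> (min_outside \<Omega> ratio)"
  using lo ratio_bounds by (intro necessity_measure_min_outside[OF finite, where z = lo])
    (auto simp: ratio_def)

lemma min_outside_ratio_eq_0:
  assumes "i \<in> \<Omega> - A" "d i \<le> 0"
  shows "min_outside \<Omega> ratio A = 0"
  using min_outside_eq[OF finite assms(1), of ratio] assms ratio_bounds by (auto simp: ratio_def)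

text \<open>Linear programming duality. Let \<open>k\<close> minimize \<open>d\<close> off
  \<open>A\<close>. The affine function of \<open>d\<close> that is 1 at \<open>lo\<close> and 0 at
  \<open>k\<close> is at most 0 off \<open>A\<close> and at most 1 on \<open>A\<close>; its mean
  under every \<open>q\<close> is its value at \<open>d = 0\<close>, which bounds
  \<open>sum q A\<close> from below. The two-point vector on \<open>{k, lo}\<close> attains the
  bound.\<close>

lemma is_lower_positive:
  assumes A: "A \<subseteq> \<Omega>" "A \<noteq> \<Omega>" and pos: "\<And>i. i \<in> \<Omega> - A \<Longrightarrow> 0 < d i"
  shows "is_lower A (weight * min_outside \<Omega> ratio A)"
proof -
  have "finite (\<Omega> - A)" "\<Omega> - A \<noteq> {}"
    using finite A by auto
  then obtain k where k: "k \<in> \<Omega> - A" and k_min: "\<And>i. i \<in> \<Omega> - A \<Longrightarrow> d k \<le> d i"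
    using arg_min_if_finite[of "\<Omega> - A" d] by (meson not_le)
  have dk: "0 < d k" "d k - d lo > 0"
    using pos[OF k] lo by auto
  have "min_outside \<Omega> ratio A = ratio k"
    using finite k k_min by (intro min_outside_eq) (auto intro: ratio_mono ratio_bounds)
  then have v: "weight * min_outside \<Omega> ratio A = d k / (d k - d lo)"
    using dk weight by (simp add: ratio_def)
  have "d k / (d k - d lo) \<le> sum q A" if q: "q \<in> mart_vecs \<Omega> d" for q
  proof -
    have q': "\<And>i. i \<in> \<Omega> \<Longrightarrow> 0 \<le> q i" "sum q \<Omega> = 1" "(\<Sum>i\<in>\<Omega>. q i * d i) = 0"
      using q by (auto simp: mart_vecs_def)
    \<comment> \<open>The affine function \<open>(d k - d i) / (d k - d lo)\<close> of \<open>d i\<close> lies below the indicator of \<open>A\<close>.\<close>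
    have "(d k - d i) / (d k - d lo) \<le> of_bool (i \<in> A)" if "i \<in> \<Omega>" for i
      using k_min[of i] bounds(1)[OF that] that dk by (auto simp: divide_simps)
    then have "(\<Sum>i\<in>\<Omega>. q i * ((d k - d i) / (d k - d lo))) \<le> (\<Sum>i\<in>\<Omega>. q i * of_bool (i \<in> A))"
      using q' by (intro sum_mono mult_left_mono) auto
    also have "\<dots> = sum q A"
      using A finite by (simp add: of_bool_def if_distrib sum.If_cases Int_absorb1 cong: if_cong)
    also have "(\<Sum>i\<in>\<Omega>. q i * ((d k - d i) / (d k - d lo))) =
        (d k * sum q \<Omega> - (\<Sum>i\<in>\<Omega>. q i * d i)) / (d k - d lo)"
      by (simp add: sum_divide_distrib sum_subtractf sum_distrib_left algebra_simps diff_divide_distrib)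
    finally show ?thesis
      using q' by simp
  qed
  \<comment> \<open>Positivity of \<open>d\<close> off \<open>A\<close> forces \<open>lo\<close>
    into \<open>A\<close>, so exactly the mass on \<open>lo\<close> counts.\<close>
  moreover have "sum (two_point \<Omega> k lo (d k / (d k - d lo))) A = d k / (d k - d lo)"
    using sum_two_point[OF finite A(1), where f = "\<lambda>_. 1"] k lo pos[of lo] by force
  moreover have "two_point \<Omega> k lo (d k / (d k - d lo)) \<in> mart_vecs \<Omega> d"
    using k lo dk finite by (intro two_point_in_mart_vecs) auto
  ultimately show ?thesis
    unfolding is_lower_def v by blast
qed

text \<open>Some martingale vector is carried by \<open>{i, j}\<close>, or by \<open>j\<close>
  alone, and gives \<open>A\<close> no mass.\<close>

lemma is_lower_mixed:
  assumes A: "A \<subseteq> \<Omega>" and i: "i \<in> \<Omega> - A" "0 \<le> d i" and j: "j \<in> \<Omega> - A" "d j \<le> 0"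
  shows "is_lower A 0"
proof -
  have nonneg: "0 \<le> sum q A" if "q \<in> mart_vecs \<Omega> d" for q
    using that A by (intro sum_nonneg) (auto simp: mart_vecs_def)
  show ?thesis
  proof (cases "d j = 0")
    case True
    \<comment> \<open>Unit mass at \<open>j\<close>, already of mean zero; \<open>lo\<close> enters
      with coefficient 0 as the strictly negative second point.\<close>
    have "two_point \<Omega> j lo 0 \<in> mart_vecs \<Omega> d"
      using two_point_in_mart_vecs[OF finite, of j lo d] j lo True by simp
    moreover have "sum (two_point \<Omega> j lo 0) A = 0"
      using sum_two_point[OF finite A, where f = "\<lambda>_. 1"] j by simp
    ultimately show ?thesis
      using nonneg unfolding is_lower_def by blast
  next
    case False
    let ?q = "two_point \<Omega> i j (d i / (d i - d j))"
    have "?q \<in> mart_vecs \<Omega> d"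
      using i j False finite by (intro two_point_in_mart_vecs) auto
    moreover have "sum ?q A = 0"
      using sum_two_point[OF finite A, where f = "\<lambda>_. 1"] i j by simp
    ultimately show ?thesis
      using nonneg unfolding is_lower_def by blast
  qed
qed

lemma is_lower_whole: "is_lower \<Omega> 1"
proof -
  have "two_point \<Omega> hi lo (d hi / (d hi - d lo)) \<in> mart_vecs \<Omega> d"
    using finite lo hi by (intro two_point_in_mart_vecs) auto
  then show ?thesis
    unfolding is_lower_def by (auto simp: mart_vecs_def)
qed

text \<open>Reflection: negating \<open>d\<close> exchanges \<open>lo\<close> and \<open>hi\<close>
  and fixes the polytope, so results for \<open>d > 0\<close> off \<open>A\<close> transfer to
  \<open>d < 0\<close>.\<close>

lemma mean_zero_uminus: "mean_zero \<Omega> (\<lambda>i. - d i) hi lo"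
  by unfold_locales (use finite lo hi bounds in auto)

interpretation neg: mean_zero \<Omega> "\<lambda>i. - d i" hi lo
  by (rule mean_zero_uminus)

lemma neg_is_lower: "neg.is_lower A v = is_lower A v"
  by (simp add: is_lower_def neg.is_lower_def mart_vecs_uminus)

lemma neg_weight: "neg.weight = 1 - weight"
  using lo hi by (simp add: weight_def neg.weight_def field_simps)

theorem is_lower_min_outside:
  assumes A: "A \<subseteq> \<Omega>"
  shows "is_lower A
    (weight * min_outside \<Omega> ratio A + (1 - weight) * min_outside \<Omega> neg.ratio A)"
proof -
  \<comment> \<open>A point off \<open>A\<close> with \<open>d i \<le> 0\<close> makes the first
    minimum vanish, one with \<open>0 \<le> d i\<close> the second. So for a proper subset at most
    one term survives.\<close>
  consider "A = \<Omega>" | i j where "i \<in> \<Omega> - A" "0 \<le> d i" "j \<in> \<Omega> - A" "d j \<le> 0"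
    | "A \<noteq> \<Omega>" "\<And>i. i \<in> \<Omega> - A \<Longrightarrow> 0 < d i" | "A \<noteq> \<Omega>" "\<And>i. i \<in> \<Omega> - A \<Longrightarrow> d i < 0"
    by (meson not_le)
  then show ?thesis
  proof cases
    case 1
    then show ?thesis
      using is_lower_whole by (simp add: min_outside_def)
  next
    case 2
    then show ?thesis
      using is_lower_mixed[OF A] min_outside_ratio_eq_0[of j A] neg.min_outside_ratio_eq_0[of i A]
      by simp
  next
    case 3
    then obtain i where "i \<in> \<Omega> - A" "0 < d i"
      using A by blast
    then show ?thesis
      using is_lower_positive[OF A 3] neg.min_outside_ratio_eq_0[of i A] by simp
  next
    case 4
    then obtain i where "i \<in> \<Omega> - A" "d i < 0"
      using A by blast
    then have "min_outside \<Omega> ratio A = 0"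
      by (intro min_outside_ratio_eq_0[of i]) auto
    then show ?thesis
      using neg.is_lower_positive[OF A 4(1)] 4(2) by (simp add: neg_is_lower neg_weight)
  qed
qed

text \<open>The average of martingale vectors \<open>w i\<close> that charge \<open>i\<close>, each
  a two-point vector whose other point is \<open>lo\<close> if \<open>0 \<le> d i\<close> and
  \<open>hi\<close> otherwise.\<close>

lemma positive_mart_vec: "\<exists>q\<in>mart_vecs \<Omega> d. \<forall>i\<in>\<Omega>. 0 < q i"
proof -
  have "\<exists>q\<in>mart_vecs \<Omega> d. 0 < q i" if i: "i \<in> \<Omega>" for i
  proof (cases "0 \<le> d i")
    case True
    have "d i / (d i - d lo) < 1" "i \<noteq> lo"
      using True lo by auto
    then have "0 < two_point \<Omega> i lo (d i / (d i - d lo)) i"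
      using i by (simp add: two_point_def)
    then show ?thesis
      using two_point_in_mart_vecs[OF finite i lo True] by blast
  next
    case False
    have "0 < d hi / (d hi - d i)" "i \<noteq> hi"
      using False hi by auto
    then have "0 < two_point \<Omega> hi i (d hi / (d hi - d i)) i"
      using i by (simp add: two_point_def)
    then show ?thesis
      using two_point_in_mart_vecs[OF finite hi(1) i, of d] False hi by force
  qed
  then obtain w where w: "\<And>i. i \<in> \<Omega> \<Longrightarrow> w i \<in> mart_vecs \<Omega> d" "\<And>i. i \<in> \<Omega> \<Longrightarrow> 0 < w i i"
    by metis
  have card: "0 < card \<Omega>"
    using finite lo by (auto simp: card_gt_0_iff)
  define q where "q = (\<lambda>k\<in>\<Omega>. (\<Sum>i\<in>\<Omega>. w i k) / card \<Omega>)"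
  have nonneg: "0 \<le> w i k" if "i \<in> \<Omega>" "k \<in> \<Omega>" for i k
    using w that by (auto simp: mart_vecs_def)
  have "0 < q k" if "k \<in> \<Omega>" for k
    using that nonneg w card finite sum_pos2[of \<Omega> k "\<lambda>i. w i k"] by (auto simp: q_def)
  moreover have "(\<Sum>k\<in>\<Omega>. q k * f k) = (\<Sum>i\<in>\<Omega>. \<Sum>k\<in>\<Omega>. w i k * f k) / card \<Omega>" for f
    by (subst sum.swap) (simp add: q_def sum_divide_distrib sum_distrib_right)
  from this[of "\<lambda>_. 1"] this[of d] have "sum q \<Omega> = 1" "(\<Sum>k\<in>\<Omega>. q k * d k) = 0"
    using w(1) card by (simp_all add: mart_vecs_def)
  ultimately show ?thesis
    by (intro bexI[of _ q]) (auto simp: mart_vecs_def q_def less_imp_le)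
qed

end

section \<open>Topology of the polytope\<close>

lemma closedin_mart_vecs:
  assumes "finite \<Omega>"
  shows "closedin (powertop_real \<Omega>) (mart_vecs \<Omega> d)"
\<comment> \<open>Without coordinates the intersection of half-spaces below would be the whole type;
  in that case the set is empty, since an empty sum is not 1.\<close>
proof (cases "\<Omega> = {}")
  case True
  then show ?thesis
    by (simp add: mart_vecs_def)
next
  case False
  let ?X = "powertop_real \<Omega>"
  have proj: "continuous_map ?X euclideanreal (\<lambda>q. q i)" if "i \<in> \<Omega>" for i
    using continuous_map_product_projection[OF that, of "\<lambda>_. euclideanreal"] by simp
  have "mart_vecs \<Omega> d = (\<Inter>i\<in>\<Omega>. {q \<in> topspace ?X. q i \<in> {0..}})
      \<inter> {q \<in> topspace ?X. sum q \<Omega> \<in> {1}} \<inter> {q \<in> topspace ?X. (\<Sum>i\<in>\<Omega>. q i * d i) \<in> {0}}"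
    using False by (auto simp: mart_vecs_def PiE_def)
  also have "closedin ?X \<dots>"
    using False assms
    by (intro closedin_Int closedin_INT closedin_continuous_map_preimage[where Y = euclideanreal]
        continuous_map_sum continuous_map_real_mult proj) auto
  finally show ?thesis .
qed

text \<open>Every \<open>q\<close> is the limit of strictly positive vectors on the segment from
  \<open>q\<close> to a strictly positive \<open>p\<close>.\<close>

theorem closure_of_positive_mart_vecs:
  assumes "mean_zero \<Omega> d lo hi"
  shows "powertop_real \<Omega> closure_of {q \<in> mart_vecs \<Omega> d. \<forall>i\<in>\<Omega>. 0 < q i} = mart_vecs \<Omega> d"
    (is "?X closure_of ?P = _")
proof
  interpret mean_zero \<Omega> d lo hi by fact
  show "?X closure_of ?P \<subseteq> mart_vecs \<Omega> d"
    by (rule closure_of_minimal) (auto intro: closedin_mart_vecs finite)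
  obtain p where p: "p \<in> mart_vecs \<Omega> d" "\<And>i. i \<in> \<Omega> \<Longrightarrow> 0 < p i"
    using positive_mart_vec by blast
  show "mart_vecs \<Omega> d \<subseteq> ?X closure_of ?P"
  proof
    fix q assume q: "q \<in> mart_vecs \<Omega> d"
    \<comment> \<open>The coefficient is positive and at most 1, so \<open>u k\<close> is a convex
      combination with positive weight on \<open>p\<close>.\<close>
    define u where "u k = (\<lambda>i\<in>\<Omega>. q i + inverse (real (Suc k)) * (p i - q i))" for k
    have pos: "0 < u k i" if i: "i \<in> \<Omega>" for i k
    proof -
      have "0 \<le> (1 - inverse (real (Suc k))) * q i" "0 < inverse (real (Suc k)) * p i"
        using q p i by (auto simp: mart_vecs_def field_simps)
      then show ?thesis
        using i by (simp add: u_def algebra_simps)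
    qed
    have sums: "(\<Sum>i\<in>\<Omega>. u k i * f i) = (\<Sum>i\<in>\<Omega>. q i * f i) +
        inverse (real (Suc k)) * ((\<Sum>i\<in>\<Omega>. p i * f i) - (\<Sum>i\<in>\<Omega>. q i * f i))" for f k
      by (simp add: u_def algebra_simps sum.distrib sum_distrib_left sum_subtractf)
    have u: "u k \<in> ?P" for k
      using q p pos sums[of k "\<lambda>_. 1"] sums[of k d]
      by (auto simp: mart_vecs_def u_def less_imp_le)
    have "(\<lambda>k. q i + inverse (real (Suc k)) * (p i - q i)) \<longlonglongrightarrow> q i + 0 * (p i - q i)" for i
      by (intro tendsto_intros LIMSEQ_inverse_real_of_nat)
    then have "limitin ?X u q sequentially"
      using q by (auto simp: limitin_componentwise mart_vecs_def u_def)
    moreover have "\<forall>\<^sub>F k in sequentially. u k \<in> ?X closure_of ?P"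
    proof -
      have "?P \<subseteq> ?X closure_of ?P"
        by (rule closure_of_subset) (auto simp: mart_vecs_def PiE_def)
      then show ?thesis
        using u by (intro always_eventually) blast
    qed
    ultimately show "q \<in> ?X closure_of ?P"
      by (rule limitin_closedin[OF _ closedin_closure_of]) simp
  qed
qed

section \<open>Equivalent martingale measures\<close>

lemma prob_on_eq_point_measure:
  assumes "prob_on \<Omega> Q" "finite \<Omega>"
  shows "Q = point_measure \<Omega> (\<lambda>i. measure Q {i})"
proof -
  interpret prob_space Q
    using assms by (simp add: prob_on_def)
  show ?thesis
    using assms
    by (intro measure_eqI_finite[where A = \<Omega>])
      (auto simp: prob_on_def sets_point_measure emeasure_point_measure_finite emeasure_eq_measure)
qed

text \<open>Translates equivalence with \<open>P\<close>, whose only null set is empty, into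
  vectors. Since \<open>ennreal\<close> sends negative numbers to 0, a nonzero point mass means
  \<open>0 < q i\<close>.\<close>

lemma null_sets_point_measure_trivial_iff:
  "null_sets (point_measure \<Omega> (\<lambda>i. ennreal (q i))) = {{}} \<longleftrightarrow> (\<forall>i\<in>\<Omega>. 0 < q i)"
  (is "?N = _ \<longleftrightarrow> _")
proof
  assume *: "?N = {{}}"
  show "\<forall>i\<in>\<Omega>. 0 < q i"
  proof
    fix i assume "i \<in> \<Omega>"
    moreover have "{i} \<notin> ?N"
      unfolding * by simp
    ultimately show "0 < q i"
      by (simp add: null_sets_point_measure_iff ennreal_eq_0_iff)
  qed
next
  assume "\<forall>i\<in>\<Omega>. 0 < q i"
  then have "X \<in> ?N \<longleftrightarrow> X = {}" for X
    by (fastforce simp: null_sets_point_measure_iff ennreal_eq_0_iff)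
  then show "?N = {{}}"
    by blast
qed

lemma prob_vec_image_emm:
  assumes P: "prob_on {1..n} P" "\<And>i. i \<in> {1..n} \<Longrightarrow> 0 < measure P {i}"
    and "0 < 1 + r" "0 < S0"
  shows "prob_vec n ` emm n m r S0 P =
    {q \<in> mart_vecs {1..n} (\<lambda>i. m i - (1 + r)). \<forall>i\<in>{1..n}. 0 < q i}"
    (is "_ = {q \<in> mart_vecs ?\<Omega> ?d. _}")
proof -
  have "null_sets P = {{}}"
    using prob_on_eq_point_measure[OF P(1)] P(2) null_sets_point_measure_trivial_iff[of ?\<Omega>]
    by (metis finite_atLeastAtMost)
  then have null: "null_sets (point_measure ?\<Omega> (\<lambda>i. ennreal (q i))) = null_sets P \<longleftrightarrow>
      (\<forall>i\<in>?\<Omega>. 0 < q i)" for q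
    by (simp only: null_sets_point_measure_trivial_iff)
  \<comment> \<open>\<open>S0\<close> cancels, and as \<open>q\<close> has total mass 1, the
    constant \<open>1 + r\<close> can be moved under the sum.\<close>
  have price: "inverse (1 + r) * (\<integral>i. stock1 m S0 i \<partial>point_measure ?\<Omega> q) = S0 \<longleftrightarrow>
      (\<Sum>i\<in>?\<Omega>. q i * ?d i) = 0"
    if "\<And>i. i \<in> ?\<Omega> \<Longrightarrow> 0 \<le> q i" "sum q ?\<Omega> = 1" for q :: "nat \<Rightarrow> real"
  proof -
    have "(\<integral>i. stock1 m S0 i \<partial>point_measure ?\<Omega> q) = (\<Sum>i\<in>?\<Omega>. q i * m i) * S0"
      using that(1) by (subst lebesgue_integral_point_measure_finite)
        (auto simp: stock1_def sum_distrib_right mult.assoc)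
    moreover have "(\<Sum>i\<in>?\<Omega>. q i * ?d i) = (\<Sum>i\<in>?\<Omega>. q i * m i) - (1 + r)"
      using that(2) by (simp add: right_diff_distrib sum_subtractf flip: sum_distrib_right)
    moreover have "inverse c * (x * S0) = S0 \<longleftrightarrow> x - c = 0" if "0 < c" for c x
      using that assms(4) by (auto simp: field_simps)
    from this[OF assms(3)]
    have "inverse (1 + r) * (x * S0) = S0 \<longleftrightarrow> x - (1 + r) = 0" for x .
    ultimately show ?thesis
      by presburger
  qed
  show ?thesis
  proof (intro equalityI subsetI)
    fix q assume "q \<in> prob_vec n ` emm n m r S0 P"
    then obtain Q where Q: "Q \<in> emm n m r S0 P" "q = prob_vec n Q"
      by blast
    then have prob: "prob_on ?\<Omega> Q"
      by (simp add: emm_def)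
    interpret prob_space Q
      using prob by (simp add: prob_on_def)
    let ?q = "\<lambda>i. measure Q {i}"
    have eq: "Q = point_measure ?\<Omega> ?q"
      using prob by (rule prob_on_eq_point_measure) simp
    have "space Q = ?\<Omega>"
      using prob sets_eq_imp_space_eq[of Q "count_space ?\<Omega>"] by (simp add: prob_on_def)
    then have sum1: "sum ?q ?\<Omega> = 1"
      using finite_measure_eq_sum_singleton[of ?\<Omega>] prob prob_space by (auto simp: prob_on_def)
    have "inverse (1 + r) * (\<integral>i. stock1 m S0 i \<partial>point_measure ?\<Omega> ?q) = S0"
      "null_sets (point_measure ?\<Omega> ?q) = null_sets P"
      using Q(1) unfolding eq[symmetric] emm_def by auto
    then have "(\<Sum>i\<in>?\<Omega>. ?q i * ?d i) = 0" "\<forall>i\<in>?\<Omega>. 0 < ?q i"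
      using price[of ?q] null[of ?q] sum1 by auto
    then show "q \<in> {q \<in> mart_vecs ?\<Omega> ?d. \<forall>i\<in>?\<Omega>. 0 < q i}"
      using sum1 by (auto simp: Q(2) mart_vecs_def prob_vec_def)
  next
    fix q assume q: "q \<in> {q \<in> mart_vecs ?\<Omega> ?d. \<forall>i\<in>?\<Omega>. 0 < q i}"
    then have q': "\<And>i. i \<in> ?\<Omega> \<Longrightarrow> 0 \<le> q i" "sum q ?\<Omega> = 1" "(\<Sum>i\<in>?\<Omega>. q i * ?d i) = 0"
      "q \<in> extensional ?\<Omega>" "\<forall>i\<in>?\<Omega>. 0 < q i"
      by (auto simp: mart_vecs_def)
    let ?Q = "point_measure ?\<Omega> (\<lambda>i. ennreal (q i))"
    have "(\<Sum>i\<in>?\<Omega>. ennreal (q i)) = 1"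
      using q'(1,2) by (subst sum_ennreal) auto
    then have "prob_space ?Q"
      by (intro prob_space_point_measure) auto
    moreover have "inverse (1 + r) * (\<integral>i. stock1 m S0 i \<partial>?Q) = S0"
      using price[of q] q' by blast
    moreover have "null_sets ?Q = null_sets P"
      using null[of q] q' by blast
    ultimately have "?Q \<in> emm n m r S0 P"
      by (simp add: emm_def prob_on_def sets_point_measure)
    moreover have "measure ?Q {i} = q i" if "i \<in> ?\<Omega>" for i
      using that q'(1) by (simp add: Sigma_Algebra.measure_def emeasure_point_measure_finite)
    \<comment> \<open>Extensionality of \<open>q\<close> gives equality as functions on all of
      \<open>nat\<close>, beyond the indices in \<open>{1..n}\<close>.\<close>
    then have "prob_vec n ?Q = q"
      using q'(4) by (auto simp: prob_vec_def fun_eq_iff extensional_def restrict_def)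
    ultimately show "q \<in> prob_vec n ` emm n m r S0 P"
      by (metis imageI)
  qed
qed

section \<open>The n-nomial model\<close>

theorem corollary1:
  fixes n :: nat and m :: "nat \<Rightarrow> real" and r S0 :: real and P :: "nat measure"
  assumes "n > 2"
    and "\<And>i j. 1 \<le> i \<Longrightarrow> i < j \<Longrightarrow> j \<le> n \<Longrightarrow> m i > m j"
    and "m n > 0"
    and "1 + r > 0"
    and "m 1 > 1 + r" and "1 + r > m n"
    and "S0 > 0"
    and "prob_on {1..n} P" and "\<And>i. i \<in> {1..n} \<Longrightarrow> measure P {i} > 0"
  shows "completely_monotone {1..n} (lower_env n (emm n m r S0 P)) \<and>
    (\<exists>N1 N2 \<alpha>. necessity_measure {1..n} N1 \<and> necessity_measure {1..n} N2 \<and>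
           \<alpha> \<in> {0<..<1} \<and>
           (\<forall>A\<in>Pow {1..n}. lower_env n (emm n m r S0 P) A = \<alpha> * N1 A + (1 - \<alpha>) * N2 A))"
proof -
  let ?\<Omega> = "{1..n}" and ?d = "\<lambda>i. m i - (1 + r)"
  have "m n \<le> m i" "m i \<le> m 1" if "i \<in> ?\<Omega>" for i
    using that assms(2)[of i n] assms(2)[of 1 i] by (cases "i = n"; cases "i = 1"; auto)+
  \<comment> \<open>As \<open>m\<close> decreases, \<open>lo\<close> is \<open>n\<close> and
    \<open>hi\<close> is \<open>1\<close>; \<open>m 1 > 1 + r > m n\<close> gives the two strict
    signs.\<close>
  then have mz: "mean_zero ?\<Omega> ?d n 1"
    using assms by unfold_locales auto
  then interpret mean_zero ?\<Omega> ?d n 1 .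
  interpret neg: mean_zero ?\<Omega> "\<lambda>i. - ?d i" 1 n
    by (rule mean_zero_uminus)
  have cl: "cl_measures n (emm n m r S0 P) = mart_vecs ?\<Omega> ?d"
    unfolding cl_measures_def
    by (subst prob_vec_image_emm) (use assms closure_of_positive_mart_vecs[OF mz] in auto)
  let ?N1 = "min_outside ?\<Omega> ratio" and ?N2 = "min_outside ?\<Omega> neg.ratio"
  \<comment> \<open>The bound and its attainment in \<open>is_lower\<close> together determine the
    \<open>LEAST\<close>.\<close>
  have env: "lower_env n (emm n m r S0 P) A = weight * ?N1 A + (1 - weight) * ?N2 A"
    if "A \<in> Pow ?\<Omega>" for A
    using is_lower_min_outside[of A] that unfolding lower_env_def cl is_lower_def
    by (intro Least_equality) (blast intro: rev_image_eqI sym)+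
  have "completely_monotone ?\<Omega> (lower_env n (emm n m r S0 P))"
    by (rule completely_monotone_combination[where a = weight and b = "1 - weight", OF
          necessity_measure_completely_monotone[OF necessity_measure_ratio]
          necessity_measure_completely_monotone[OF neg.necessity_measure_ratio]])
      (use weight env in auto)
  then show ?thesis
    using necessity_measure_ratio neg.necessity_measure_ratio weight env
    by (intro conjI exI[of _ ?N1] exI[of _ ?N2] exI[of _ weight]) auto
qed

end
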